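(* Let $0<\lambda\le 1$ and $\theta\in[0,2\pi)$. The function $$f_{\theta}(z)=\frac{z}{1-(1+\lambda)e^{i\theta}z+\lambda e^{2i\theta}z^2},\qquad z\in\mathbb{D},$$ is convex in the direction $2\pi-\theta$.
   Context: $\mathbb{D}=\{z\in\mathbb{C}:|z|<1\}$. A domain $D\subset\mathbb{C}$ is convex in the direction $\gamma$ if every line parallel to the line through $0$ and $e^{i\gamma}$ has a connected (possibly empty) intersection with $D$; thus the condition depends only on $\gamma$ modulo $\pi$. A function $f$ analytic in $\mathbb{D}$ is called convex in the direction $\gamma$ if $f$ is univalent (injective) in $\mathbb{D}$ and $f(\mathbb{D})$ is a domain convex in the direction $\gamma$. *)

theory Defs
  imports "HOL-Complex_Analysis.Complex_Analysis"
begin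

definition line_in_direction :: "complex \<Rightarrow> real \<Rightarrow> complex set" where
  "line_in_direction a \<gamma> = range (\<lambda>t::real. a + of_real t * exp (\<i> * of_real \<gamma>))"

definition is_domain :: "complex set \<Rightarrow> bool" where
  "is_domain D \<longleftrightarrow> open D \<and> connected D \<and> D \<noteq> {}"

definition domain_convex_in_direction :: "complex set \<Rightarrow> real \<Rightarrow> bool" where
  "domain_convex_in_direction D \<gamma> \<longleftrightarrow>
     is_domain D \<and> (\<forall>a. connected (line_in_direction a \<gamma> \<inter> D))"

definition convex_in_direction :: "(complex \<Rightarrow> complex) \<Rightarrow> real \<Rightarrow> bool" where
  "convex_in_direction f \<gamma> \<longleftrightarrow>
     f analytic_on ball 0 1 \<and> inj_on f (ball 0 1) \<and>
     domain_convex_in_direction (f ` ball 0 1) \<gamma>"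

end

theory Submission
  imports Defs
begin

text \<open>
  Up to rotation, \<open>f\<close> is \<open>F w = w / ((1 - w) (1 - \<lambda> w))\<close>, and
  \<open>1 / F w = 1 / w + \<lambda> w - (1 + \<lambda>)\<close> is a Joukowski map, so \<open>1 / F\<close> sends the disc onto the
  exterior of an ellipse (a segment if \<open>\<lambda> = 1\<close>) with foci \<open>-\<alpha>\<close> and \<open>-\<beta>\<close>, where
  \<open>\<alpha> = (1 + \<surd>\<lambda>)\<^sup>2\<close> and \<open>\<beta> = (1 - \<surd>\<lambda>)\<^sup>2\<close>. In terms of \<open>u = F w\<close> this exterior reads
  \<open>(\<bar>1 + \<alpha> u\<bar> - \<alpha> \<bar>u\<bar>) + (\<bar>1 + \<beta> u\<bar> - \<beta> \<bar>u\<bar>) > 0\<close>. By convexity of the modulus both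
  brackets are nondecreasing in the real part of \<open>u\<close>, so every horizontal line meets the image
  of \<open>F\<close> in a right half-line, in the full line, or not at all.
\<close>

text \<open>The two middle points lie on the segment from \<open>x\<close> to
  \<open>x + (s + c) *\<^sub>R v\<close> with complementary weights \<open>t\<close> and
  \<open>1 - t\<close>. Adding the two convexity inequalities cancels the weights.\<close>

lemma norm_shift_supermodular:
  fixes x v :: "'a::real_normed_vector"
  assumes "0 \<le> s" "0 \<le> c"
  shows "norm (x + s *\<^sub>R v) + norm (x + c *\<^sub>R v) \<le> norm (x + (s + c) *\<^sub>R v) + norm x"
proof (cases "s + c = 0")
  case True
  then have "s = 0" "c = 0" using assms by auto
  then show ?thesis by simp
next
  case False
  define t where "t = s / (s + c)"
  have t: "0 \<le> t" "0 \<le> 1 - t" and st: "t * (s + c) = s" and ct: "(1 - t) * (s + c) = c"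
    using assms False by (auto simp: t_def field_simps)
  have convex: "norm (x + (r * (s + c)) *\<^sub>R v) \<le> r * norm (x + (s + c) *\<^sub>R v) + (1 - r) * norm x"
    if "0 \<le> r" "0 \<le> 1 - r" for r
  proof -
    have "x + (r * (s + c)) *\<^sub>R v = r *\<^sub>R (x + (s + c) *\<^sub>R v) + (1 - r) *\<^sub>R x"
      by (simp add: algebra_simps)
    also have "norm \<dots> \<le> norm (r *\<^sub>R (x + (s + c) *\<^sub>R v)) + norm ((1 - r) *\<^sub>R x)"
      by (rule norm_triangle_ineq)
    finally show ?thesis using that by simp
  qed
  show ?thesis
    using convex[of t] convex[of "1 - t"] t unfolding st ct by (simp add: algebra_simps)
qed

text \<open>The bracket is the increment of the modulus over the unit step from
  \<open>\<alpha> * u\<close> to \<open>\<alpha> * u + 1\<close>. Increments of a convex function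
  over steps of fixed length grow as the starting point moves right.\<close>

lemma norm_one_plus_mult_mono:
  fixes u :: complex
  assumes "0 \<le> \<alpha>" "0 \<le> s"
  shows "norm (1 + of_real \<alpha> * u) - \<alpha> * norm u
    \<le> norm (1 + of_real \<alpha> * (u + of_real s)) - \<alpha> * norm (u + of_real s)"
proof -
  have "norm (of_real \<alpha> * u + of_real (\<alpha> * s)) + norm (of_real \<alpha> * u + 1)
      \<le> norm (of_real \<alpha> * u + of_real (\<alpha> * s + 1)) + norm (of_real \<alpha> * u)"
    using norm_shift_supermodular[of "\<alpha> * s" 1 "of_real \<alpha> * u" 1] assms
    by (simp add: scaleR_conv_of_real)
  also have "of_real \<alpha> * u + of_real (\<alpha> * s + 1) = 1 + of_real \<alpha> * (u + of_real s)"
    by (simp add: algebra_simps)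
  also have "of_real \<alpha> * u + of_real (\<alpha> * s) = of_real \<alpha> * (u + of_real s)"
    by (simp add: algebra_simps)
  also have "of_real \<alpha> * u + 1 = 1 + of_real \<alpha> * u"
    by (rule add.commute)
  finally show ?thesis
    using assms(1) unfolding norm_mult by simp
qed

definition two_pole_map :: "real \<Rightarrow> complex \<Rightarrow> complex" where
  "two_pole_map l w = w / ((1 - w) * (1 - of_real l * w))"

text \<open>With v = 1/u this is the focal-distance inequality |v + \<alpha>| + |v + \<beta>| >
  \<alpha> + \<beta>, multiplied by |u| so that u = 0, that is v = \<infinity>, is included.\<close>

definition joukowski_exterior :: "real \<Rightarrow> complex set" where
  "joukowski_exterior l = {u.
     0 < (norm (1 + of_real ((1 + sqrt l)\<^sup>2) * u) - (1 + sqrt l)\<^sup>2 * norm u)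
       + (norm (1 + of_real ((1 - sqrt l)\<^sup>2) * u) - (1 - sqrt l)\<^sup>2 * norm u)}"

lemma joukowski_exterior_shift:
  assumes "u \<in> joukowski_exterior l" "0 \<le> s"
  shows "u + of_real s \<in> joukowski_exterior l"
  using assms norm_one_plus_mult_mono[of "(1 + sqrt l)\<^sup>2" s u]
    norm_one_plus_mult_mono[of "(1 - sqrt l)\<^sup>2" s u]
  by (simp add: joukowski_exterior_def)

lemma denominator_nonzero:
  fixes w :: complex
  assumes "0 < l" "l \<le> 1" "norm w < 1"
  shows "1 - w \<noteq> 0" "1 - of_real l * w \<noteq> 0"
proof -
  show "1 - w \<noteq> 0" using assms by auto
  have "norm (of_real l * w) < 1"
    using assms mult_le_one[of l "norm w"] mult_less_cancel_right2[of l "norm w"]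
    by (smt (verit) norm_mult norm_of_real norm_ge_zero mult_left_le_one_le)
  then show "1 - of_real l * w \<noteq> 0" by auto
qed

text \<open>Over the common denominator \<open>d\<close> both focal terms become perfect squares,
  and the parallelogram law adds their moduli. Points outside the disc are allowed because the
  surjectivity argument first meets an arbitrary root.\<close>

lemma two_pole_map_in_exterior_iff:
  fixes w :: complex
  assumes "0 < l" "1 - w \<noteq> 0" "1 - of_real l * w \<noteq> 0"
  shows "two_pole_map l w \<in> joukowski_exterior l \<longleftrightarrow> 0 < (1 - norm w) * (1 - l * norm w)"
proof -
  define k where "k = sqrt l"
  have k: "l = k\<^sup>2" "0 < k" using assms by (auto simp: k_def)
  define d where "d = (1 - w) * (1 - of_real l * w)"
  have d: "d \<noteq> 0" using assms by (simp add: d_def)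
  have factor: "norm (1 + of_real ((1 + j)\<^sup>2) * (w / d)) = (norm (1 + of_real j * w))\<^sup>2 / norm d"
    if "j\<^sup>2 = l" for j
  proof -
    have l: "l = j\<^sup>2" using that by simp
    have "d + of_real ((1 + j)\<^sup>2) * w = (1 + of_real j * w)\<^sup>2"
      unfolding d_def l by (simp add: power2_eq_square algebra_simps)
    then have "1 + of_real ((1 + j)\<^sup>2) * (w / d) = (1 + of_real j * w)\<^sup>2 / d"
      using d by (simp add: field_simps)
    then show ?thesis by (simp add: norm_divide norm_power)
  qed
  have par: "(norm (1 + of_real k * w))\<^sup>2 + (norm (1 - of_real k * w))\<^sup>2 = 2 * (1 + l * (norm w)\<^sup>2)"
    unfolding cmod_power2 k by (simp add: power2_eq_square algebra_simps)
  have "two_pole_map l w \<in> joukowski_exterior l \<longleftrightarrow>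
      0 < ((norm (1 + of_real k * w))\<^sup>2 / norm d - (1 + k)\<^sup>2 * norm w / norm d)
        + ((norm (1 - of_real k * w))\<^sup>2 / norm d - (1 - k)\<^sup>2 * norm w / norm d)"
    unfolding two_pole_map_def joukowski_exterior_def d_def[symmetric] k_def[symmetric] mem_Collect_eq
    using factor[of k] factor[of "-k"] k(1) by (simp add: norm_divide del: of_real_power)
  also have "((norm (1 + of_real k * w))\<^sup>2 / norm d - (1 + k)\<^sup>2 * norm w / norm d)
        + ((norm (1 - of_real k * w))\<^sup>2 / norm d - (1 - k)\<^sup>2 * norm w / norm d)
      = ((norm (1 + of_real k * w))\<^sup>2 + (norm (1 - of_real k * w))\<^sup>2
         - ((1 + k)\<^sup>2 + (1 - k)\<^sup>2) * norm w) / norm d"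
    by (simp add: add_divide_distrib diff_divide_distrib algebra_simps)
  also have "\<dots> = 2 * ((1 - norm w) * (1 - l * norm w)) / norm d"
    unfolding par by (simp add: k(1) power2_eq_square algebra_simps)
  finally show ?thesis using d by (simp add: zero_less_divide_iff)
qed

text \<open>For surjectivity, \<open>two_pole_map l w = u\<close> is a quadratic in \<open>w\<close>
  whose roots have product 1/l. The sign criterion leaves |w| < 1 or l |w| > 1, and in the second
  case the other root is in the disc.\<close>

lemma image_two_pole_map:
  assumes l: "0 < l" "l \<le> 1"
  shows "two_pole_map l ` ball 0 1 = joukowski_exterior l"
proof (intro equalityI subsetI)
  fix u assume "u \<in> two_pole_map l ` ball 0 1"
  then obtain w where w: "norm w < 1" "u = two_pole_map l w" by auto
  have "l * norm w < 1"
    using l w(1) by (smt (verit) norm_ge_zero mult_left_le_one_le)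
  then show "u \<in> joukowski_exterior l"
    using two_pole_map_in_exterior_iff[OF l(1) denominator_nonzero[OF l w(1)]] w by simp
next
  fix u assume u: "u \<in> joukowski_exterior l"
  show "u \<in> two_pole_map l ` ball 0 1"
  proof (cases "u = 0")
    case True
    then show ?thesis by (auto simp: two_pole_map_def intro!: image_eqI[of _ _ 0])
  next
    case False
    \<comment> \<open>Clearing denominators gives l u w^2 - b w + u = 0; \<open>w\<close> is the
      root from the quadratic formula, and either square root would serve.\<close>
    define b where "b = (1 + of_real l) * u + 1"
    define q where "q = csqrt (b\<^sup>2 - 4 * of_real l * u\<^sup>2)"
    define w where "w = (b + q) / (2 * of_real l * u)"
    have nz: "2 * of_real l * u \<noteq> 0" using False l by simp
    have q: "q\<^sup>2 = b\<^sup>2 - 4 * of_real l * u\<^sup>2" by (simp add: q_def)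
    have bq: "b + q = 2 * of_real l * u * w" using nz by (simp add: w_def)
    have "(2 * of_real l * u * w - b)\<^sup>2 = b\<^sup>2 - 4 * of_real l * u\<^sup>2"
      using q bq by (metis add_diff_cancel_left')
    then have "4 * of_real l * u * (of_real l * u * w\<^sup>2 - b * w + u) = 0"
      by (simp add: power2_eq_square algebra_simps)
    then have "of_real l * u * w\<^sup>2 - b * w + u = 0" using nz by simp
    then have root: "u * ((1 - w) * (1 - of_real l * w)) = w"
      by (simp add: b_def power2_eq_square algebra_simps)
    then have w0: "w \<noteq> 0" using False by auto
    then have d: "1 - w \<noteq> 0" "1 - of_real l * w \<noteq> 0" using root by auto
    have uw: "u = two_pole_map l w"
      using root d unfolding two_pole_map_def by (simp add: eq_divide_eq)
    have pos: "0 < (1 - norm w) * (1 - l * norm w)"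
      using two_pole_map_in_exterior_iff[OF l(1) d] u uw by simp
    show ?thesis
    proof (cases "norm w < 1")
      case True
      then show ?thesis using uw by auto
    next
      case False
      \<comment> \<open>The other root of the quadratic is \<open>1 / (l w)\<close>.\<close>
      define w' where "w' = 1 / (of_real l * w)"
      have "1 < l * norm w" using pos False by (simp add: zero_less_mult_iff)
      then have "norm w' < 1"
        using l by (simp add: w'_def norm_divide norm_mult)
      moreover have "two_pole_map l w' = two_pole_map l w"
      proof -
        have lw: "of_real l * w \<noteq> 0" using l w0 by simp
        \<comment> \<open>Scaling by l w^2 swaps the two factors of the denominator and turns the
          numerator \<open>w'\<close> into \<open>w\<close>.\<close>
        then have "(1 - w') * (1 - of_real l * w') * (of_real l * w * w)
            = (1 - w) * (1 - of_real l * w)"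
          by (simp add: w'_def field_simps)
        moreover have "w' * (of_real l * w * w) = w"
          using lw by (simp add: w'_def)
        ultimately show ?thesis
          using lw unfolding two_pole_map_def
          by (metis mult_divide_mult_cancel_right mult_eq_0_iff)
      qed
      ultimately show ?thesis using uw by (auto intro!: image_eqI[of _ _ w'])
    qed
  qed
qed

text \<open>The cross-multiplied equation factors, and its second factor is a denominator factor
  evaluated at the point \<open>x * y\<close> of the disc.\<close>

lemma inj_on_two_pole_map:
  assumes l: "0 < l" "l \<le> 1"
  shows "inj_on (two_pole_map l) (ball 0 1)"
proof (rule inj_onI)
  fix x y assume "x \<in> ball 0 1" "y \<in> ball 0 1" and eq: "two_pole_map l x = two_pole_map l y"
  then have n: "norm x < 1" "norm y < 1" by auto
  have "x * ((1 - y) * (1 - of_real l * y)) = y * ((1 - x) * (1 - of_real l * x))"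
    using eq denominator_nonzero[OF l n(1)] denominator_nonzero[OF l n(2)]
    by (simp add: two_pole_map_def frac_eq_eq)
  then have "(x - y) * (1 - of_real l * (x * y)) = 0"
    by (simp add: algebra_simps)
  moreover have "norm (x * y) < 1"
    using n by (smt (verit) norm_mult norm_ge_zero mult_left_le_one_le)
  then have "1 - of_real l * (x * y) \<noteq> 0"
    by (rule denominator_nonzero(2)[OF l])
  ultimately show "x = y" by simp
qed

theorem theorem1:
  fixes lam \<theta> :: real
  assumes "0 < lam" and "lam \<le> 1"
    and "0 \<le> \<theta>" and "\<theta> < 2 * pi"
  shows "convex_in_direction
    (\<lambda>z. z / (1 - (1 + of_real lam) * exp (\<i> * of_real \<theta>) * z
                + of_real lam * exp (2 * \<i> * of_real \<theta>) * z\<^sup>2))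
    (2 * pi - \<theta>)"
proof -
  note l = assms(1,2)
  define e where "e = exp (\<i> * of_real \<theta>)"
  have e: "norm e = 1" "e \<noteq> 0" by (auto simp: e_def)
  have e2: "exp (2 * \<i> * of_real \<theta>) = e\<^sup>2"
    by (simp add: e_def exp_double[symmetric] mult.assoc)
  have dir: "exp (\<i> * of_real (2 * pi - \<theta>)) = 1 / e"
    by (simp add: e_def right_diff_distrib exp_diff mult.commute)
  \<comment> \<open>The inner rotation preserves the disc; the outer division by \<open>e\<close>
    turns horizontal lines into lines of direction \<open>1 / e\<close>.\<close>
  define f where "f = (\<lambda>z. two_pole_map lam (e * z) / e)"
  have f_eq: "(\<lambda>z. z / (1 - (1 + of_real lam) * exp (\<i> * of_real \<theta>) * z
                + of_real lam * exp (2 * \<i> * of_real \<theta>) * z\<^sup>2)) = f"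
  proof
    fix z
    have "1 - (1 + of_real lam) * e * z + of_real lam * e\<^sup>2 * z\<^sup>2
        = (1 - e * z) * (1 - of_real lam * (e * z))"
      by (simp add: power2_eq_square algebra_simps)
    then show "z / (1 - (1 + of_real lam) * exp (\<i> * of_real \<theta>) * z
        + of_real lam * exp (2 * \<i> * of_real \<theta>) * z\<^sup>2) = f z"
      unfolding f_def two_pole_map_def e2 e_def[symmetric] using e by simp
  qed
  have rot: "e * z \<in> ball 0 1 \<longleftrightarrow> z \<in> ball 0 1" for z
    using e by (simp add: norm_mult)
  have "bij_betw ((*) e) (ball 0 1) (ball 0 1)"
    using e rot by (intro bij_betwI[of _ _ _ "\<lambda>z. z / e"]) (auto simp: norm_mult norm_divide)
  then have "(*) e ` ball 0 1 = ball 0 1" by (rule bij_betw_imp_surj_on)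
  then have "(\<lambda>z. two_pole_map lam (e * z)) ` ball 0 1 = joukowski_exterior lam"
    using image_two_pole_map[OF l] by (metis image_image)
  moreover have "f ` ball 0 1 = (\<lambda>u. u / e) ` (\<lambda>z. two_pole_map lam (e * z)) ` ball 0 1"
    by (simp add: f_def image_image)
  ultimately have "f ` ball 0 1 = (\<lambda>u. u / e) ` joukowski_exterior lam" by simp
  then have image: "u \<in> f ` ball 0 1 \<longleftrightarrow> e * u \<in> joukowski_exterior lam" for u
    using e by (auto intro!: image_eqI[of _ _ "e * u"])
  have hol: "f holomorphic_on ball 0 1"
    unfolding f_def two_pole_map_def
    using e denominator_nonzero[OF l] rot by (intro holomorphic_intros) (auto simp: norm_mult)
  have inj: "inj_on f (ball 0 1)"
  proof (rule inj_onI)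
    fix x y assume "x \<in> ball 0 1" "y \<in> ball 0 1" "f x = f y"
    then have "e * x = e * y"
      using inj_onD[OF inj_on_two_pole_map[OF l], of "e * x" "e * y"] rot e by (simp add: f_def)
    then show "x = y" using e by simp
  qed
  have "is_domain (f ` ball 0 1)"
    unfolding is_domain_def
    using open_mapping_thm3[OF hol _ inj] hol
    by (auto intro!: connected_continuous_image holomorphic_on_imp_continuous_on)
  moreover have "connected (line_in_direction a (2 * pi - \<theta>) \<inter> f ` ball 0 1)" for a
  proof -
    \<comment> \<open>Multiplying a + t/e by \<open>e\<close> gives the horizontal line e a + t. The
      parameter set \<open>T\<close> is upward closed, hence an interval.\<close>
    define T where "T = {t::real. e * a + of_real t \<in> joukowski_exterior lam}"
    have "t \<in> T" if "s \<in> T" "s \<le> t" for s t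
      using joukowski_exterior_shift[of "e * a + of_real s" lam "t - s"] that
      by (simp add: T_def)
    then have "connected T"
      unfolding is_interval_connected_1[symmetric] is_interval_1 by blast
    moreover have "a + of_real t * (1 / e) \<in> f ` ball 0 1 \<longleftrightarrow> t \<in> T" for t
      unfolding image T_def using e by (simp add: distrib_left)
    then have "line_in_direction a (2 * pi - \<theta>) \<inter> f ` ball 0 1
        = (\<lambda>t. a + of_real t * (1 / e)) ` T"
      unfolding line_in_direction_def dir by blast
    ultimately show ?thesis
      by (auto intro!: connected_continuous_image continuous_intros simp: e)
  qed
  ultimately show ?thesis
    unfolding f_eq convex_in_direction_def domain_convex_in_direction_def
    using hol inj analytic_on_open[of "ball 0 1" f] by simp
qed

end
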